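(* Let $d,p\in\mathbb{N}$, $a\geq 0$, and $\Omega\subset\mathbb{R}^d$. The native space of $k_{a,p}$ on $\Omega$ is $\mathcal{H}_{a,p}(\Omega)=\mathbb{P}_p^d(\Omega)$ if $a>0$ and $\mathcal{H}_{0,p}(\Omega)=\mathbb{H}_p^d(\Omega)$ if $a=0$, with the inner product $$\langle f,g\rangle_{\mathcal{H}_{a,p}}:=\sum_{\gamma\in I_a(p,d)}\frac{1}{w_\gamma^a}\,D^\gamma f(0)\,D^\gamma g(0),\qquad f,g\in\mathcal{H}_{a,p}(\Omega).$$
   Context: The polynomial kernel is $k_{a,p}(x,y):=(a+\langle x,y\rangle)^p$, $x,y\in\Omega$, with the Euclidean inner product on $\mathbb{R}^d$. Its native space (reproducing kernel Hilbert space) $\mathcal{H}_{a,p}(\Omega)$ is the unique Hilbert space of functions $\Omega\to\mathbb{R}$ with $k_{a,p}(\cdot,x)\in\mathcal{H}_{a,p}(\Omega)$ for all $x\in\Omega$ and $\langle k_{a,p}(\cdot,x),f\rangle_{\mathcal{H}_{a,p}}=f(x)$ for all $x\in\Omega$, $f\in\mathcal{H}_{a,p}(\Omega)$. $\mathbb{P}_p^d(\Omega)$ is the space of real $d$-variate polynomials of total degree at most $p$ over $\Omega$, and $\mathbb{H}_p^d(\Omega)$ the corresponding space of homogeneous polynomials of degree $p$ over $\Omega$. For multi-indices, $|\zeta|=\zeta_1+\dots+\zeta_d$ and $\zeta!=\zeta_1!\cdots\zeta_d!$; $I_a(p,d):=\{\zeta\in\mathbb{N}_0^d: |\zeta|\le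 p\}$ if $a>0$ and $I_0(p,d):=\{\zeta\in\mathbb{N}_0^d: |\zeta|=p\}$. The weights are $w_\zeta^a:=\frac{p!\,\zeta!}{(p-|\zeta|)!}\,a^{p-|\zeta|}$ if $a>0$, and $w_\zeta^0:=p!\,\zeta!$ if $a=0$, for $\zeta\in I_a(p,d)$. $D^\gamma f(0)$ is the partial derivative of multi-index $\gamma$ of the polynomial $f$, evaluated at the origin (so $D^\gamma f(0)=\gamma!\,c_\gamma$ for $f=\sum_\beta c_\beta x^\beta$).
   Formalization: If Ω does not determine the polynomial (e.g. Ω={0}), D^γ f(0) is ill-defined; there it is taken for the polynomial in the space of least norm restricting to f. When restriction to Ω is injective on the polynomial space, the formula holds literally. *)

theory Defs
  imports "HOL-Analysis.Analysis"
begin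

text \<open>
  A function \<open>\<Omega> \<rightarrow> \<real>\<close> is a total function in \<^term>\<open>extensional \<Omega>\<close>, i.e. one that is fixed to
  \<^const>\<open>undefined\<close> outside \<open>\<Omega>\<close>; two such functions are equal iff they agree on \<open>\<Omega>\<close>.  The
  vector space operations are pointwise on \<open>\<Omega>\<close>.  Only the values of \<open>ip\<close> on \<open>H \<times> H\<close> matter.
\<close>

definition fun_diff :: "'v set \<Rightarrow> ('v \<Rightarrow> real) \<Rightarrow> ('v \<Rightarrow> real) \<Rightarrow> 'v \<Rightarrow> real" where
  "fun_diff \<Omega> f g = (\<lambda>x\<in>\<Omega>. f x - g x)"

locale hilbert_function_space =
  fixes \<Omega> :: "'v set"
    and H :: "('v \<Rightarrow> real) set"
    and ip :: "('v \<Rightarrow> real) \<Rightarrow> ('v \<Rightarrow> real) \<Rightarrow> real"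
  assumes subset_extensional: "H \<subseteq> extensional \<Omega>"
    and zero: "(\<lambda>x\<in>\<Omega>. 0) \<in> H"
    and add: "\<lbrakk>f \<in> H; g \<in> H\<rbrakk> \<Longrightarrow> (\<lambda>x\<in>\<Omega>. f x + g x) \<in> H"
    and scale: "f \<in> H \<Longrightarrow> (\<lambda>x\<in>\<Omega>. r * f x) \<in> H"
    and ip_commute: "\<lbrakk>f \<in> H; g \<in> H\<rbrakk> \<Longrightarrow> ip f g = ip g f"
    and ip_add: "\<lbrakk>f \<in> H; g \<in> H; h \<in> H\<rbrakk> \<Longrightarrow> ip (\<lambda>x\<in>\<Omega>. f x + g x) h = ip f h + ip g h"
    and ip_scale: "\<lbrakk>f \<in> H; g \<in> H\<rbrakk> \<Longrightarrow> ip (\<lambda>x\<in>\<Omega>. r * f x) g = r * ip f g"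
    and ip_pos: "\<lbrakk>f \<in> H; f \<noteq> (\<lambda>x\<in>\<Omega>. 0)\<rbrakk> \<Longrightarrow> 0 < ip f f"
    and complete: "\<lbrakk>\<And>n. s n \<in> H;
        \<forall>e>0. \<exists>N. \<forall>m\<ge>N. \<forall>n\<ge>N. sqrt (ip (fun_diff \<Omega> (s m) (s n)) (fun_diff \<Omega> (s m) (s n))) < e\<rbrakk>
      \<Longrightarrow> \<exists>f\<in>H. (\<lambda>n. sqrt (ip (fun_diff \<Omega> (s n) f) (fun_diff \<Omega> (s n) f))) \<longlonglongrightarrow> 0"

locale native_space = hilbert_function_space \<Omega> H ip
  for \<Omega> :: "'v set" and k :: "'v \<Rightarrow> 'v \<Rightarrow> real"
    and H :: "('v \<Rightarrow> real) set" and ip :: "('v \<Rightarrow> real) \<Rightarrow> ('v \<Rightarrow> real) \<Rightarrow> real" +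
  assumes kernel_section: "x \<in> \<Omega> \<Longrightarrow> (\<lambda>y\<in>\<Omega>. k y x) \<in> H"
    and reproducing: "\<lbrakk>x \<in> \<Omega>; f \<in> H\<rbrakk> \<Longrightarrow> ip (\<lambda>y\<in>\<Omega>. k y x) f = f x"

definition poly_kernel :: "real \<Rightarrow> nat \<Rightarrow> real ^ 'n \<Rightarrow> real ^ 'n \<Rightarrow> real" where
  "poly_kernel a p x y = (a + x \<bullet> y) ^ p"

definition mi_abs :: "('n::finite \<Rightarrow> nat) \<Rightarrow> nat" where
  "mi_abs \<zeta> = (\<Sum>i\<in>UNIV. \<zeta> i)"

definition mi_fact :: "('n::finite \<Rightarrow> nat) \<Rightarrow> real" where
  "mi_fact \<zeta> = (\<Prod>i\<in>UNIV. fact (\<zeta> i))"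

definition mi_power :: "real ^ 'n \<Rightarrow> ('n \<Rightarrow> nat) \<Rightarrow> real" where
  "mi_power x \<zeta> = (\<Prod>i\<in>UNIV. (x $ i) ^ \<zeta> i)"

definition index_set :: "real \<Rightarrow> nat \<Rightarrow> ('n::finite \<Rightarrow> nat) set" where
  "index_set a p = (if a > 0 then {\<zeta>. mi_abs \<zeta> \<le> p} else {\<zeta>. mi_abs \<zeta> = p})"

definition weight :: "real \<Rightarrow> nat \<Rightarrow> ('n::finite \<Rightarrow> nat) \<Rightarrow> real" where
  "weight a p \<zeta> =
     (if a > 0 then fact p * mi_fact \<zeta> / fact (p - mi_abs \<zeta>) * a ^ (p - mi_abs \<zeta>)
      else fact p * mi_fact \<zeta>)"

definition polys :: "nat \<Rightarrow> (real ^ 'n \<Rightarrow> real) set" where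
  "polys p = {F. \<exists>c. F = (\<lambda>x. \<Sum>\<zeta> | mi_abs \<zeta> \<le> p. c \<zeta> * mi_power x \<zeta>)}"

definition hom_polys :: "nat \<Rightarrow> (real ^ 'n \<Rightarrow> real) set" where
  "hom_polys p = {F. \<exists>c. F = (\<lambda>x. \<Sum>\<zeta> | mi_abs \<zeta> = p. c \<zeta> * mi_power x \<zeta>)}"

lemma finite_mi_abs_le: "finite {\<zeta>::'n::finite \<Rightarrow> nat. mi_abs \<zeta> \<le> p}"
proof (rule finite_subset)
  show "{\<zeta>::'n \<Rightarrow> nat. mi_abs \<zeta> \<le> p} \<subseteq> PiE UNIV (\<lambda>_. {..p})"
  proof (clarsimp simp: mi_abs_def PiE_def extensional_def)
    fix \<zeta> :: "'n \<Rightarrow> nat" and i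
    assume "sum \<zeta> UNIV \<le> p"
    moreover have "\<zeta> i \<le> sum \<zeta> UNIV" by (rule member_le_sum) auto
    ultimately show "\<zeta> i \<le> p" by linarith
  qed
qed (auto intro: finite_PiE)

lemma finite_index_set: "finite (index_set a p :: ('n::finite \<Rightarrow> nat) set)"
  by (rule finite_subset[OF _ finite_mi_abs_le[of p]]) (auto simp: index_set_def)

definition poly_space :: "real \<Rightarrow> nat \<Rightarrow> (real ^ 'n \<Rightarrow> real) set" where
  "poly_space a p = (if a > 0 then polys p else hom_polys p)"

definition poly_space_on :: "real \<Rightarrow> nat \<Rightarrow> (real ^ 'n) set \<Rightarrow> (real ^ 'n \<Rightarrow> real) set" where
  "poly_space_on a p \<Omega> = (\<lambda>F. restrict F \<Omega>) ` poly_space a p"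

definition partial_deriv :: "'n \<Rightarrow> (real ^ 'n \<Rightarrow> real) \<Rightarrow> real ^ 'n \<Rightarrow> real" where
  "partial_deriv i F x = deriv (\<lambda>t. F (x + t *\<^sub>R axis i 1)) 0"

text \<open>
  The index type carries no order, so the directions are differentiated in an arbitrarily chosen
  order in which each \<open>i\<close> occurs \<open>\<gamma> i\<close> times.  For polynomials the order is irrelevant.
\<close>

definition mi_deriv :: "('n \<Rightarrow> nat) \<Rightarrow> (real ^ 'n \<Rightarrow> real) \<Rightarrow> real ^ 'n \<Rightarrow> real" where
  "mi_deriv \<gamma> F = foldr partial_deriv (SOME is. \<forall>i. count_list is i = \<gamma> i) F"

definition poly_ip :: "real \<Rightarrow> nat \<Rightarrow> (real ^ 'n \<Rightarrow> real) \<Rightarrow> (real ^ 'n \<Rightarrow> real) \<Rightarrow> real" where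
  "poly_ip a p F G = (\<Sum>\<gamma>\<in>index_set a p. 1 / weight a p \<gamma> * mi_deriv \<gamma> F 0 * mi_deriv \<gamma> G 0)"

text \<open>
  A function on \<open>\<Omega>\<close> may be the restriction of several polynomials of the space (for instance if
  \<open>\<Omega>\<close> is finite), and then its derivatives at the origin depend on the polynomial chosen.  The
  representative taken is the one of smallest norm.  If \<open>\<Omega>\<close> determines the polynomials of the
  space, then there is only one candidate and the minimisation is vacuous.
\<close>

definition poly_rep ::
  "real \<Rightarrow> nat \<Rightarrow> (real ^ 'n) set \<Rightarrow> (real ^ 'n \<Rightarrow> real) \<Rightarrow> real ^ 'n \<Rightarrow> real" where
  "poly_rep a p \<Omega> f =
     (ARG_MIN (\<lambda>F. poly_ip a p F F) F. F \<in> poly_space a p \<and> restrict F \<Omega> = f)"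

lemma poly_rep_restrict:
  assumes "inj_on (\<lambda>F. restrict F \<Omega>) (poly_space a p)" and "F \<in> poly_space a p"
  shows "poly_rep a p \<Omega> (restrict F \<Omega>) = F"
proof -
  have "(G \<in> poly_space a p \<and> restrict G \<Omega> = restrict F \<Omega>) \<longleftrightarrow> G = F" for G
    using assms by (auto dest: inj_onD)
  then show ?thesis
    by (auto simp: poly_rep_def arg_min_def is_arg_min_def intro!: some_equality)
qed

end

theory Submission
  imports Defs
begin

text \<open>
  The multinomial theorem writes the kernel as
  \<open>k(x, y) = \<Sum>\<zeta>. w \<zeta> / (\<zeta>!)\<^sup>2 * x\<^sup>\<zeta> * y\<^sup>\<zeta>\<close>, the sum being over the index set
  (\<open>poly_kernel_expansion\<close>).  Since \<open>D\<^sup>\<gamma> F(0) = \<gamma>! c\<^sub>\<gamma>\<close> for a polynomial \<open>F\<close> with coefficients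
  \<open>c\<close> (\<open>mi_deriv_at_0\<close>), the claimed inner product is diagonal in the coefficients with weights
  \<open>(\<gamma>!)\<^sup>2 / w \<gamma>\<close>, precisely the reciprocals of the weights of the kernel.  A space of finite
  combinations of functions \<open>\<phi>\<close> with such a diagonal product reproduces its kernel and is complete
  because convergence is convergence of finitely many coefficients
  (\<open>finite_feature_native_space\<close>).  So the polynomials on the whole of \<open>\<real>\<^sup>d\<close> form a native space.

  The passage to \<open>\<Omega>\<close> follows Aronszajn: functions on \<open>\<Omega>\<close> carry the norm of their smallest extension
  (\<open>native_space_restrict\<close>).  In general that requires orthogonal projection onto a closed subspace.
  Here everything is finite-dimensional, and it is enough to know that finitely many points \<open>X\<close> of
  \<open>\<Omega>\<close> exist such that each section \<open>k(_, y)\<close> with \<open>y \<in> \<Omega>\<close> is a combination of the sections at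
  points of \<open>X\<close>.  Each function of a native space then agrees on \<open>\<Omega>\<close> with one combination of these
  sections (\<open>interpolation_on\<close>), by Gram--Schmidt and the reproducing property alone, and that
  combination is orthogonal to everything vanishing on \<open>\<Omega>\<close>: it is the extension of least norm, and
  it depends linearly on the function.

  The same points give uniqueness of the native space without a density argument
  (\<open>native_space_unique\<close>): the space consists of the combinations of sections at \<open>X\<close>, and the
  reproducing property dictates their inner products.  Existence and uniqueness together are the
  equivalence claimed.  If restriction to \<open>\<Omega>\<close> is injective on the polynomials, then the smallest
  extension of \<open>F|\<Omega>\<close> is \<open>F\<close>, which gives the second equivalence.
\<close>

section \<open>Interpolation by kernel sections\<close>

lemma fun_diff_eq:
  "fun_diff \<Omega> f g = (\<lambda>x\<in>\<Omega>. f x + (\<lambda>x\<in>\<Omega>. (- 1) * g x) x)"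
  by (auto simp: fun_diff_def restrict_def)

lemma (in hilbert_function_space) fun_diff_closed:
  "\<lbrakk>f \<in> H; g \<in> H\<rbrakk> \<Longrightarrow> fun_diff \<Omega> f g \<in> H"
  unfolding fun_diff_eq using add scale by blast

lemma (in hilbert_function_space) ip_diff_left:
  "\<lbrakk>f \<in> H; g \<in> H; h \<in> H\<rbrakk> \<Longrightarrow> ip (fun_diff \<Omega> f g) h = ip f h - ip g h"
  unfolding fun_diff_eq using ip_add[of f "\<lambda>x\<in>\<Omega>. (- 1) * g x" h] scale[of g "-1"]
    ip_scale[of g h "-1"] by simp

lemma (in hilbert_function_space) ip_zero_left: "f \<in> H \<Longrightarrow> ip (\<lambda>x\<in>\<Omega>. 0) f = 0"
  using ip_scale[of "\<lambda>x\<in>\<Omega>. 0" f 0] zero by (simp add: restrict_def)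

lemma (in hilbert_function_space) ip_nonneg: "f \<in> H \<Longrightarrow> 0 \<le> ip f f"
  using ip_pos[of f] ip_zero_left[OF zero] by (cases "f = (\<lambda>x\<in>\<Omega>. 0)") auto

lemma (in hilbert_function_space) eq_zero_if_ip_zero:
  "\<lbrakk>f \<in> H; ip f f = 0; x \<in> \<Omega>\<rbrakk> \<Longrightarrow> f x = 0"
  using ip_pos[of f] by (cases "f = (\<lambda>x\<in>\<Omega>. 0)") auto

definition kernel_comb :: "'v set \<Rightarrow> ('v \<Rightarrow> 'v \<Rightarrow> real) \<Rightarrow> 'v set \<Rightarrow> ('v \<Rightarrow> real) \<Rightarrow> 'v \<Rightarrow> real" where
  "kernel_comb \<Omega> k X b = (\<lambda>y\<in>\<Omega>. \<Sum>x\<in>X. b x * k y x)"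

lemma kernel_comb_empty: "kernel_comb \<Omega> k {} b = (\<lambda>x\<in>\<Omega>. 0)"
  by (simp only: kernel_comb_def sum.empty)

lemma kernel_comb_insert:
  assumes "finite X" "z \<notin> X"
  shows "kernel_comb \<Omega> k (insert z X) b
    = (\<lambda>y\<in>\<Omega>. (\<lambda>y\<in>\<Omega>. b z * (\<lambda>y\<in>\<Omega>. k y z) y) y + kernel_comb \<Omega> k X b y)"
  using assms by (auto simp: kernel_comb_def restrict_def)

lemma (in native_space) kernel_comb_closed:
  "\<lbrakk>finite X; X \<subseteq> \<Omega>\<rbrakk> \<Longrightarrow> kernel_comb \<Omega> k X b \<in> H"
proof (induction X rule: finite_induct)
  case empty
  then show ?case using zero by (simp only: kernel_comb_empty)
next
  case (insert z X)
  show ?case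
    unfolding kernel_comb_insert[OF insert.hyps(1,2)]
    using insert by (intro add scale kernel_section) auto
qed

lemma (in native_space) ip_kernel_comb:
  "\<lbrakk>finite X; X \<subseteq> \<Omega>; f \<in> H\<rbrakk> \<Longrightarrow> ip (kernel_comb \<Omega> k X b) f = (\<Sum>x\<in>X. b x * f x)"
proof (induction X rule: finite_induct)
  case empty
  then show ?case using ip_zero_left by (simp only: kernel_comb_empty sum.empty)
next
  case (insert z X)
  have z: "z \<in> \<Omega>" and X: "X \<subseteq> \<Omega>" using insert.prems by auto
  show ?case
    unfolding kernel_comb_insert[OF insert.hyps(1,2)]
    using ip_add[OF scale[OF kernel_section[OF z]] kernel_comb_closed[OF insert.hyps(1) X] insert.prems(2), of "b z" b]
      ip_scale[OF kernel_section[OF z] insert.prems(2), of "b z"]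
      insert.IH[OF X insert.prems(2)] reproducing[OF z insert.prems(2)] insert.hyps
    by (simp only: sum.insert not_False_eq_True)
qed

text \<open>
  Gram--Schmidt, one node at a time.  Let \<open>u\<close> be the part of the section at the new node \<open>z\<close>
  orthogonal to the old sections; by the reproducing property this means that \<open>u\<close> vanishes at the
  old nodes.  Adding a multiple of \<open>u\<close> therefore changes no value at a node other than \<open>z\<close>.  If
  \<open>u\<close> is zero, no correction is possible; but then the section at \<open>z\<close> is a combination of the old
  ones, and the interpolant is already right at \<open>z\<close>.
\<close>
lemma (in native_space) interpolation:
  assumes "finite X" "X \<subseteq> \<Omega>" "f \<in> H"
  shows "\<exists>b. \<forall>x\<in>X. kernel_comb \<Omega> k X b x = f x"
  using assms
proof (induction X arbitrary: f rule: finite_induct)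
  case empty
  then show ?case by simp
next
  case (insert z X)
  have z: "z \<in> \<Omega>" and X: "X \<subseteq> \<Omega>" and f: "f \<in> H" using insert.prems by auto
  have kz: "(\<lambda>y\<in>\<Omega>. k y z) \<in> H" by (rule kernel_section[OF z])
  obtain b where b: "\<forall>x\<in>X. kernel_comb \<Omega> k X b x = f x" using insert.IH[OF X f] by blast
  obtain c where c: "\<forall>x\<in>X. kernel_comb \<Omega> k X c x = k x z"
    using insert.IH[OF X kz] X by (metis (no_types, lifting) restrict_apply' subsetD)
  define u where "u = fun_diff \<Omega> (\<lambda>y\<in>\<Omega>. k y z) (kernel_comb \<Omega> k X c)"
  define d where "d = fun_diff \<Omega> f (kernel_comb \<Omega> k X b)"
  have uH: "u \<in> H" and dH: "d \<in> H"
    unfolding u_def d_def using kz f kernel_comb_closed[OF insert.hyps(1) X]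
    by (auto intro: fun_diff_closed)
  have ux: "u x = 0" and dx: "d x = 0" if "x \<in> X" for x
    using that b c X by (auto simp: u_def d_def fun_diff_def)
  have ipu: "ip u h = h z - (\<Sum>x\<in>X. c x * h x)" if "h \<in> H" for h
    unfolding u_def using ip_diff_left[OF kz kernel_comb_closed[OF insert.hyps(1) X] that]
      ip_kernel_comb[OF insert.hyps(1) X that] reproducing[OF z that] by simp
  (* The terms of ipu at the old nodes vanish both for u and for the interpolation error d. *)
  have uu: "ip u u = u z" and ud: "ip u d = d z" using ipu uH dH ux dx by auto
  (* If u has norm zero, then d z = ip u d = 0, so the error at z is zero as well. *)
  have ex: "\<exists>t. d z = t * u z"
  proof (cases "u z = 0")
    case True
    then have "u = (\<lambda>x\<in>\<Omega>. 0)" using ip_pos[OF uH] uu by fastforce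
    then show ?thesis using ud ip_zero_left[OF dH] by auto
  next
    case False
    then have "d z = (d z / u z) * u z" by simp
    then show ?thesis by blast
  qed
  then obtain t where t: "d z = t * u z" by blast
  define e where "e x = (if x = z then t else b x - t * c x)" for x
  have e: "kernel_comb \<Omega> k (insert z X) e y = kernel_comb \<Omega> k X b y + t * u y" if "y \<in> \<Omega>" for y
  proof -
    have "(\<Sum>x\<in>X. e x * k y x) = (\<Sum>x\<in>X. b x * k y x - t * (c x * k y x))"
      using insert.hyps by (intro sum.cong) (auto simp: e_def algebra_simps)
    then show ?thesis
      using insert.hyps that
      by (simp add: kernel_comb_def u_def fun_diff_def sum_subtractf sum_distrib_left e_def algebra_simps)
  qed
  have "kernel_comb \<Omega> k (insert z X) e x = f x" if "x \<in> insert z X" for x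
  proof (cases "x = z")
    case True
    then show ?thesis using e[OF z] t z by (simp add: d_def fun_diff_def)
  next
    case False
    then show ?thesis using e[of x] ux[of x] b X that by auto
  qed
  then show ?case by blast
qed

section \<open>Finitely many sections that determine a native space\<close>

text \<open>
  The sections at points of \<open>\<Theta>\<close> are compared on all of \<open>\<Omega>\<close>, not only on \<open>\<Theta>\<close>: in a native space on
  \<open>\<Omega>\<close> this makes the values on \<open>X\<close> determine those on \<open>\<Theta>\<close>, and the sections at \<open>X\<close> are the
  functions needed to extend from \<open>\<Theta>\<close> to \<open>\<Omega>\<close>.
\<close>
definition spanning_nodes :: "'v set \<Rightarrow> 'v set \<Rightarrow> ('v \<Rightarrow> 'v \<Rightarrow> real) \<Rightarrow> 'v set \<Rightarrow> bool" where
  "spanning_nodes \<Omega> \<Theta> k X \<longleftrightarrow> finite X \<and> X \<subseteq> \<Theta> \<and>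
     (\<forall>y\<in>\<Theta>. \<exists>c. (\<lambda>z\<in>\<Omega>. k z y) = kernel_comb \<Omega> k X c)"

lemma (in native_space) eq_zero_on_if_zero_on_nodes:
  assumes "spanning_nodes \<Omega> \<Theta> k X" "\<Theta> \<subseteq> \<Omega>" "f \<in> H" "\<And>x. x \<in> X \<Longrightarrow> f x = 0" "y \<in> \<Theta>"
  shows "f y = 0"
proof -
  have X: "finite X" "X \<subseteq> \<Omega>" using assms by (auto simp: spanning_nodes_def)
  obtain c where c: "(\<lambda>z\<in>\<Omega>. k z y) = kernel_comb \<Omega> k X c"
    using assms by (auto simp: spanning_nodes_def)
  have "f y = ip (\<lambda>z\<in>\<Omega>. k z y) f" using reproducing assms by auto
  also have "\<dots> = (\<Sum>x\<in>X. c x * f x)" unfolding c by (rule ip_kernel_comb[OF X assms(3)])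
  also have "\<dots> = 0" using assms(4) by simp
  finally show ?thesis .
qed

lemma (in native_space) interpolation_on:
  assumes "spanning_nodes \<Omega> \<Theta> k X" "\<Theta> \<subseteq> \<Omega>" "f \<in> H"
  shows "\<exists>b. restrict (kernel_comb \<Omega> k X b) \<Theta> = restrict f \<Theta>"
proof -
  have X: "finite X" "X \<subseteq> \<Omega>" using assms by (auto simp: spanning_nodes_def)
  obtain b where b: "\<forall>x\<in>X. kernel_comb \<Omega> k X b x = f x" using interpolation[OF X assms(3)] by blast
  have "fun_diff \<Omega> f (kernel_comb \<Omega> k X b) x = 0" if "x \<in> X" for x
    using b X that by (auto simp: fun_diff_def)
  from eq_zero_on_if_zero_on_nodes[OF assms(1,2) fun_diff_closed[OF assms(3) kernel_comb_closed[OF X]] this]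
  have "fun_diff \<Omega> f (kernel_comb \<Omega> k X b) y = 0" if "y \<in> \<Theta>" for y
    using that by simp
  then have "\<forall>y\<in>\<Theta>. kernel_comb \<Omega> k X b y = f y" using assms(2) by (auto simp: fun_diff_def subset_iff)
  then show ?thesis by (auto intro: restrict_ext)
qed

lemma (in native_space) carrier_eq_kernel_combs:
  assumes "spanning_nodes \<Omega> \<Omega> k X"
  shows "H = range (kernel_comb \<Omega> k X)"
proof -
  have X: "finite X" "X \<subseteq> \<Omega>" using assms by (auto simp: spanning_nodes_def)
  have "f \<in> range (kernel_comb \<Omega> k X)" if f: "f \<in> H" for f
  proof -
    obtain b where "restrict (kernel_comb \<Omega> k X b) \<Omega> = restrict f \<Omega>"
      using interpolation_on[OF assms _ f] by blast
    moreover have "restrict f \<Omega> = f" using f subset_extensional by (auto simp: extensional_restrict)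
    moreover have "restrict (kernel_comb \<Omega> k X b) \<Omega> = kernel_comb \<Omega> k X b"
      by (simp add: kernel_comb_def)
    ultimately show ?thesis by auto
  qed
  then show ?thesis using kernel_comb_closed[OF X] by blast
qed

text \<open>
  The combinations of sections at the nodes exhaust both spaces, and the product of such a
  combination \<open>\<Sum>x. b x * k(_, x)\<close> with \<open>g\<close> must be \<open>\<Sum>x. b x * g x\<close>, whatever the inner product.
\<close>
lemma native_space_unique:
  assumes "native_space \<Omega> k H ip" "native_space \<Omega> k H' ip'" "spanning_nodes \<Omega> \<Omega> k X"
  shows "H = H'" and "\<And>f g. \<lbrakk>f \<in> H; g \<in> H\<rbrakk> \<Longrightarrow> ip f g = ip' f g"
proof -
  interpret N: native_space \<Omega> k H ip by fact
  interpret N': native_space \<Omega> k H' ip' by fact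
  have X: "finite X" "X \<subseteq> \<Omega>" using assms by (auto simp: spanning_nodes_def)
  have H: "H = range (kernel_comb \<Omega> k X)" by (rule N.carrier_eq_kernel_combs[OF assms(3)])
  then show H': "H = H'" using N'.carrier_eq_kernel_combs[OF assms(3)] by simp
  fix f g assume fg: "f \<in> H" "g \<in> H"
  then obtain b where "f = kernel_comb \<Omega> k X b" using H by auto
  then show "ip f g = ip' f g"
    using N.ip_kernel_comb[OF X fg(2)] N'.ip_kernel_comb[OF X, of g] fg H' by simp
qed

lemma native_space_cong:
  assumes "native_space \<Omega> k H ip" and eq: "\<And>f g. \<lbrakk>f \<in> H; g \<in> H\<rbrakk> \<Longrightarrow> ip' f g = ip f g"
  shows "native_space \<Omega> k H ip'"
proof -
  interpret native_space \<Omega> k H ip by fact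
  show ?thesis
  proof (unfold_locales)
    fix s :: "nat \<Rightarrow> 'a \<Rightarrow> real"
    assume s: "\<And>n. s n \<in> H" and
      C: "\<forall>e>0. \<exists>N. \<forall>m\<ge>N. \<forall>n\<ge>N. sqrt (ip' (fun_diff \<Omega> (s m) (s n)) (fun_diff \<Omega> (s m) (s n))) < e"
    have "\<exists>f\<in>H. (\<lambda>n. sqrt (ip (fun_diff \<Omega> (s n) f) (fun_diff \<Omega> (s n) f))) \<longlonglongrightarrow> 0"
      by (rule complete[OF s]) (use C s eq fun_diff_closed in simp)
    then show "\<exists>f\<in>H. (\<lambda>n. sqrt (ip' (fun_diff \<Omega> (s n) f) (fun_diff \<Omega> (s n) f))) \<longlonglongrightarrow> 0"
      using s eq fun_diff_closed by simp
  next
    fix f g assume "f \<in> H" "g \<in> H"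
    then show "ip' f g = ip' g f" using eq ip_commute by metis
  qed (use subset_extensional zero add scale ip_add ip_scale ip_pos kernel_section reproducing eq
      in \<open>simp_all\<close>)
qed

section \<open>Restriction to a subset by extensions of least norm\<close>

definition min_norm_extension ::
  "('v \<Rightarrow> real) set \<Rightarrow> (('v \<Rightarrow> real) \<Rightarrow> ('v \<Rightarrow> real) \<Rightarrow> real) \<Rightarrow> 'v set \<Rightarrow> ('v \<Rightarrow> real) \<Rightarrow> 'v \<Rightarrow> real" where
  "min_norm_extension H ip \<Theta> f = (ARG_MIN (\<lambda>F. ip F F) F. F \<in> H \<and> restrict F \<Theta> = f)"

text \<open>
  Pythagoras: \<open>F - G\<close> vanishes at the nodes, hence is orthogonal to the combination \<open>G\<close> of their
  sections.  This is what makes \<open>G\<close> the extension of least norm.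
\<close>
lemma (in native_space) ip_diff_kernel_comb:
  assumes "finite X" "X \<subseteq> \<Theta>" "\<Theta> \<subseteq> \<Omega>" "F \<in> H"
    and eq: "restrict F \<Theta> = restrict (kernel_comb \<Omega> k X b) \<Theta>"
  defines "G \<equiv> kernel_comb \<Omega> k X b"
  shows "ip (fun_diff \<Omega> F G) (fun_diff \<Omega> F G) = ip F F - ip G G"
proof -
  have X: "X \<subseteq> \<Omega>" using assms by blast
  have G: "G \<in> H" unfolding G_def by (rule kernel_comb_closed[OF assms(1) X])
  have D: "fun_diff \<Omega> F G \<in> H" using fun_diff_closed[OF assms(4) G] .
  have FG: "F x = G x" if "x \<in> X" for x
    using fun_cong[OF eq, of x] that assms(2) by (auto simp: G_def)
  have "ip G (fun_diff \<Omega> F G) = (\<Sum>x\<in>X. b x * fun_diff \<Omega> F G x)"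
    unfolding G_def by (rule ip_kernel_comb[OF assms(1) X]) (use D in \<open>simp add: G_def\<close>)
  also have "\<dots> = 0" using FG X by (intro sum.neutral) (auto simp: fun_diff_def)
  finally have 0: "ip G (fun_diff \<Omega> F G) = 0" .
  then have 1: "ip F G = ip G G"
    using ip_commute[OF G D] ip_diff_left[OF assms(4) G G] by simp
  have "ip (fun_diff \<Omega> F G) (fun_diff \<Omega> F G) = ip F (fun_diff \<Omega> F G)"
    using ip_diff_left[OF assms(4) G D] 0 by simp
  also have "\<dots> = ip (fun_diff \<Omega> F G) F" by (rule ip_commute[OF assms(4) D])
  also have "\<dots> = ip F F - ip G F" by (rule ip_diff_left[OF assms(4) G assms(4)])
  finally show ?thesis using 1 ip_commute[OF assms(4) G] by simp
qed

lemma (in native_space) min_norm_extension_kernel_comb: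
  assumes X: "finite X" "X \<subseteq> \<Theta>" and \<Theta>: "\<Theta> \<subseteq> \<Omega>"
  shows "min_norm_extension H ip \<Theta> (restrict (kernel_comb \<Omega> k X b) \<Theta>) = kernel_comb \<Omega> k X b"
proof -
  define G where "G = kernel_comb \<Omega> k X b"
  have G: "G \<in> H" unfolding G_def using X \<Theta> by (intro kernel_comb_closed) auto
  have diff: "ip (fun_diff \<Omega> F G) (fun_diff \<Omega> F G) = ip F F - ip G G"
    if "F \<in> H" "restrict F \<Theta> = restrict G \<Theta>" for F
    using ip_diff_kernel_comb[OF X \<Theta> that(1)] that(2) by (simp add: G_def)
  have le: "ip G G \<le> ip F F" if "F \<in> H" "restrict F \<Theta> = restrict G \<Theta>" for F
    using diff[OF that] ip_nonneg[OF fun_diff_closed[OF that(1) G]] by simp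
  have eq: "F = G" if F: "F \<in> H" "restrict F \<Theta> = restrict G \<Theta>" "ip F F \<le> ip G G" for F
  proof (rule extensionalityI[of _ \<Omega>])
    have "ip (fun_diff \<Omega> F G) (fun_diff \<Omega> F G) = 0" using diff[OF F(1,2)] le[OF F(1,2)] F(3) by simp
    from eq_zero_if_ip_zero[OF fun_diff_closed[OF F(1) G] this]
    show "F x = G x" if "x \<in> \<Omega>" for x using that by (simp add: fun_diff_def)
  qed (use F G subset_extensional in auto)
  show ?thesis
    unfolding min_norm_extension_def G_def[symmetric] arg_min_def
  proof (rule some_equality)
    show "is_arg_min (\<lambda>F. ip F F) (\<lambda>F. F \<in> H \<and> restrict F \<Theta> = restrict G \<Theta>) G"
      using G le by (force simp: is_arg_min_def)
    show "F = G" if "is_arg_min (\<lambda>F. ip F F) (\<lambda>F. F \<in> H \<and> restrict F \<Theta> = restrict G \<Theta>) F" for F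
      using that G by (intro eq) (auto simp: is_arg_min_def not_less)
  qed
qed

text \<open>
  By interpolation every function of the restricted space is \<open>restrict (?K b) \<Theta>\<close> for some
  coefficients \<open>b\<close>, and its extension of least norm is then \<open>?K b\<close>.  In this form the extension is
  visibly linear, and all algebraic laws of the inner product transfer.
\<close>
lemma native_space_restrict:
  assumes N: "native_space \<Omega> k H ip" and \<Theta>: "\<Theta> \<subseteq> \<Omega>" and nodes: "spanning_nodes \<Omega> \<Theta> k X"
  defines "rep \<equiv> min_norm_extension H ip \<Theta>"
  shows "native_space \<Theta> k ((\<lambda>F. restrict F \<Theta>) ` H) (\<lambda>f g. ip (rep f) (rep g))"
proof -
  interpret native_space \<Omega> k H ip by fact
  have X: "finite X" "X \<subseteq> \<Theta>" using nodes by (auto simp: spanning_nodes_def)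
  then have X\<Omega>: "X \<subseteq> \<Omega>" using \<Theta> by blast
  let ?K = "kernel_comb \<Omega> k X" and ?H = "(\<lambda>F. restrict F \<Theta>) ` H"
  have K: "?K b \<in> H" for b by (rule kernel_comb_closed[OF X(1) X\<Omega>])
  have rep: "rep (restrict (?K b) \<Theta>) = ?K b" for b
    unfolding rep_def by (rule min_norm_extension_kernel_comb[OF X \<Theta>])
  have ex: "\<exists>b. f = restrict (?K b) \<Theta>" if "f \<in> ?H" for f
    using that interpolation_on[OF nodes \<Theta>] by (metis imageE)
  have mem: "restrict (?K b) \<Theta> \<in> ?H" for b using K by blast
  have rep_mem: "rep f \<in> H" and restrict_rep: "restrict (rep f) \<Theta> = f" if "f \<in> ?H" for f
    using ex[OF that] rep K by auto
  have radd: "(\<lambda>x\<in>\<Theta>. restrict (?K b) \<Theta> x + restrict (?K c) \<Theta> x) = restrict (?K (\<lambda>x. b x + c x)) \<Theta>"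
    and kadd: "?K (\<lambda>x. b x + c x) = (\<lambda>x\<in>\<Omega>. ?K b x + ?K c x)" for b c
    using \<Theta> by (auto simp: kernel_comb_def restrict_def sum.distrib algebra_simps intro!: ext)
  have rscale: "(\<lambda>x\<in>\<Theta>. r * restrict (?K b) \<Theta> x) = restrict (?K (\<lambda>x. r * b x)) \<Theta>"
    and kscale: "?K (\<lambda>x. r * b x) = (\<lambda>x\<in>\<Omega>. r * ?K b x)" for r b
    using \<Theta> by (auto simp: kernel_comb_def restrict_def sum_distrib_left algebra_simps intro!: ext)
  have rep_add: "rep (\<lambda>x\<in>\<Theta>. f x + g x) = (\<lambda>x\<in>\<Omega>. rep f x + rep g x)" if fg: "f \<in> ?H" "g \<in> ?H" for f g
  proof -
    obtain b c where "f = restrict (?K b) \<Theta>" "g = restrict (?K c) \<Theta>" using ex fg by meson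
    then show ?thesis by (simp only: radd rep) (rule kadd)
  qed
  have rep_scale: "rep (\<lambda>x\<in>\<Theta>. r * f x) = (\<lambda>x\<in>\<Omega>. r * rep f x)" if fg: "f \<in> ?H" for f r
  proof -
    obtain b where "f = restrict (?K b) \<Theta>" using ex fg by meson
    then show ?thesis by (simp only: rscale rep) (rule kscale)
  qed
  have add': "(\<lambda>x\<in>\<Theta>. f x + g x) \<in> ?H" if fg: "f \<in> ?H" "g \<in> ?H" for f g
  proof -
    obtain b c where "f = restrict (?K b) \<Theta>" "g = restrict (?K c) \<Theta>" using ex fg by meson
    then show ?thesis by (simp only: radd mem)
  qed
  have scale': "(\<lambda>x\<in>\<Theta>. r * f x) \<in> ?H" if fg: "f \<in> ?H" for f r
  proof -
    obtain b where "f = restrict (?K b) \<Theta>" using ex fg by meson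
    then show ?thesis by (simp only: rscale mem)
  qed
  have rep_diff: "rep (fun_diff \<Theta> f g) = fun_diff \<Omega> (rep f) (rep g)" if "f \<in> ?H" "g \<in> ?H" for f g
    by (simp only: fun_diff_eq rep_add[OF that(1) scale'[OF that(2)]] rep_scale[OF that(2)])
  have diff': "fun_diff \<Theta> f g \<in> ?H" if "f \<in> ?H" "g \<in> ?H" for f g
    unfolding fun_diff_eq by (intro add' scale' that)
  have zero_eq: "(\<lambda>x\<in>\<Theta>. 0) = restrict (\<lambda>x\<in>\<Omega>. 0) \<Theta>"
    using \<Theta> by (simp only: restrict_restrict Int_absorb1)
  have minimal: "ip (rep (restrict F \<Theta>)) (rep (restrict F \<Theta>)) \<le> ip F F" if F: "F \<in> H" for F
  proof -
    obtain b where b: "restrict F \<Theta> = restrict (?K b) \<Theta>" using ex F by blast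
    have "0 \<le> ip F F - ip (?K b) (?K b)"
      unfolding ip_diff_kernel_comb[OF X \<Theta> F b, symmetric] by (rule ip_nonneg[OF fun_diff_closed[OF F K]])
    then show ?thesis using b rep by simp
  qed
  show ?thesis
  proof unfold_locales
    show "?H \<subseteq> extensional \<Theta>" by auto
    show "(\<lambda>x\<in>\<Theta>. 0) \<in> ?H" using zero zero_eq by blast
  next
    fix f g assume "f \<in> ?H" "g \<in> ?H"
    then show "(\<lambda>x\<in>\<Theta>. f x + g x) \<in> ?H" by (rule add')
  next
    fix f r assume "f \<in> ?H"
    then show "(\<lambda>x\<in>\<Theta>. r * f x) \<in> ?H" by (rule scale')
  next
    fix f g assume "f \<in> ?H" "g \<in> ?H"
    then show "ip (rep f) (rep g) = ip (rep g) (rep f)" by (intro ip_commute rep_mem)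
  next
    fix f g h assume "f \<in> ?H" "g \<in> ?H" "h \<in> ?H"
    then show "ip (rep (\<lambda>x\<in>\<Theta>. f x + g x)) (rep h) = ip (rep f) (rep h) + ip (rep g) (rep h)"
      by (simp only: rep_add ip_add rep_mem)
  next
    fix f g r assume "f \<in> ?H" "g \<in> ?H"
    then show "ip (rep (\<lambda>x\<in>\<Theta>. r * f x)) (rep g) = r * ip (rep f) (rep g)"
      by (simp only: rep_scale ip_scale rep_mem)
  next
    fix f assume f: "f \<in> ?H" "f \<noteq> (\<lambda>x\<in>\<Theta>. 0)"
    have "rep f \<noteq> (\<lambda>x\<in>\<Omega>. 0)"
    proof
      assume "rep f = (\<lambda>x\<in>\<Omega>. 0)"
      then have "f = restrict (\<lambda>x\<in>\<Omega>. 0) \<Theta>" using restrict_rep[OF f(1)] by (simp only:)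
      then have "f = (\<lambda>x\<in>\<Theta>. 0)" by (rule trans[OF _ zero_eq[symmetric]])
      then show False using f(2) by contradiction
    qed
    then show "0 < ip (rep f) (rep f)" by (intro ip_pos rep_mem f)
  next
    fix s :: "nat \<Rightarrow> 'a \<Rightarrow> real"
    assume s: "\<And>n. s n \<in> ?H" and
      C: "\<forall>e>0. \<exists>N. \<forall>m\<ge>N. \<forall>n\<ge>N.
        sqrt (ip (rep (fun_diff \<Theta> (s m) (s n))) (rep (fun_diff \<Theta> (s m) (s n)))) < e"
    (* F is the limit of the least-norm extensions.  Restriction to the subset cannot increase the
       distance to it, because the restricted norm is a minimum over extensions. *)
    have "\<exists>F\<in>H. (\<lambda>n. sqrt (ip (fun_diff \<Omega> (rep (s n)) F) (fun_diff \<Omega> (rep (s n)) F))) \<longlonglongrightarrow> 0"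
      using C s by (intro complete rep_mem) (simp_all add: rep_diff)
    then obtain F where F: "F \<in> H"
      and lim: "(\<lambda>n. sqrt (ip (fun_diff \<Omega> (rep (s n)) F) (fun_diff \<Omega> (rep (s n)) F))) \<longlonglongrightarrow> 0" by blast
    define f where "f = restrict F \<Theta>"
    have f: "f \<in> ?H" using F by (simp add: f_def)
    have le: "ip (rep (fun_diff \<Theta> (s n) f)) (rep (fun_diff \<Theta> (s n) f))
        \<le> ip (fun_diff \<Omega> (rep (s n)) F) (fun_diff \<Omega> (rep (s n)) F)" for n
    proof -
      have "rep (s n) x = s n x" if "x \<in> \<Theta>" for x
        using fun_cong[OF restrict_rep[OF s[of n]], of x] that by simp
      then have "restrict (fun_diff \<Omega> (rep (s n)) F) \<Theta> = fun_diff \<Theta> (s n) f"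
        using \<Theta> by (auto simp: fun_diff_def f_def fun_eq_iff restrict_def)
      then show ?thesis using minimal[OF fun_diff_closed[OF rep_mem[OF s] F], of n] by simp
    qed
    have "(\<lambda>n. sqrt (ip (rep (fun_diff \<Theta> (s n) f)) (rep (fun_diff \<Theta> (s n) f)))) \<longlonglongrightarrow> 0"
    proof (rule tendsto_sandwich[OF _ _ tendsto_const lim])
      show "\<forall>\<^sub>F n in sequentially. 0 \<le> sqrt (ip (rep (fun_diff \<Theta> (s n) f)) (rep (fun_diff \<Theta> (s n) f)))"
        by (intro always_eventually allI real_sqrt_ge_zero ip_nonneg rep_mem diff' s f)
    qed (use le in \<open>simp add: always_eventually\<close>)
    then show "\<exists>f\<in>?H. (\<lambda>n. sqrt (ip (rep (fun_diff \<Theta> (s n) f)) (rep (fun_diff \<Theta> (s n) f)))) \<longlonglongrightarrow> 0"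
      using f by blast
  next
    fix x assume x: "x \<in> \<Theta>"
    have eq: "(\<lambda>y\<in>\<Theta>. k y x) = restrict (\<lambda>y\<in>\<Omega>. k y x) \<Theta>"
      using \<Theta> by (simp only: restrict_restrict Int_absorb1)
    show "(\<lambda>y\<in>\<Theta>. k y x) \<in> ?H"
      unfolding eq using kernel_section x \<Theta> by (intro imageI) blast
    fix f assume f: "f \<in> ?H"
    obtain c where c: "(\<lambda>y\<in>\<Omega>. k y x) = ?K c" using nodes x by (auto simp: spanning_nodes_def)
    have "ip (rep (\<lambda>y\<in>\<Theta>. k y x)) (rep f) = ip (\<lambda>y\<in>\<Omega>. k y x) (rep f)"
      unfolding eq c rep ..
    also have "\<dots> = restrict (rep f) \<Theta> x" using reproducing[OF _ rep_mem[OF f]] x \<Theta> by auto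
    finally show "ip (rep (\<lambda>y\<in>\<Theta>. k y x)) (rep f) = f x" using restrict_rep[OF f] by simp
  qed
qed

section \<open>Kernels with finitely many features\<close>

text \<open>
  The functional \<open>L i\<close> reads off the coefficient of \<open>\<phi> i\<close> up to the factor \<open>l i\<close>; its mere
  existence forces the functions \<open>\<phi> i\<close> to be linearly independent.  In the coefficients the inner
  product is diagonal with entries \<open>r i * (l i)\<^sup>2\<close>, and the reproducing property holds because the
  kernel carries the reciprocal entries.
\<close>
lemma finite_feature_native_space:
  fixes \<phi> :: "'i \<Rightarrow> 'v \<Rightarrow> real" and L :: "'i \<Rightarrow> ('v \<Rightarrow> real) \<Rightarrow> real"
  assumes I: "finite I"
    and L: "\<And>i c. i \<in> I \<Longrightarrow> L i (\<lambda>x. \<Sum>j\<in>I. c j * \<phi> j x) = l i * c i"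
    and l: "\<And>i. i \<in> I \<Longrightarrow> l i \<noteq> 0" and r: "\<And>i. i \<in> I \<Longrightarrow> r i > 0"
  shows "native_space UNIV (\<lambda>y x. \<Sum>i\<in>I. \<phi> i y * \<phi> i x / (r i * (l i)\<^sup>2))
    {F. \<exists>c. F = (\<lambda>x. \<Sum>i\<in>I. c i * \<phi> i x)} (\<lambda>F G. \<Sum>i\<in>I. r i * L i F * L i G)"
proof -
  define P where "P c = (\<lambda>x. \<Sum>i\<in>I. c i * \<phi> i x)" for c
  have L: "L i (P c) = l i * c i" if "i \<in> I" for i c using L[OF that] by (simp add: P_def)
  let ?ip = "\<lambda>F G. \<Sum>i\<in>I. r i * L i F * L i G"
  have Padd: "(\<lambda>x. P b x + P c x) = P (\<lambda>i. b i + c i)" for b c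
    by (simp add: P_def sum.distrib algebra_simps)
  have Pscale: "(\<lambda>x. t * P b x) = P (\<lambda>i. t * b i)" for t b
    by (simp add: P_def sum_distrib_left algebra_simps)
  have Pdiff: "fun_diff UNIV (P b) (P c) = P (\<lambda>i. b i - c i)" for b c
    by (simp add: P_def fun_diff_def restrict_UNIV sum_subtractf algebra_simps)
  have H: "{F. \<exists>c. F = (\<lambda>x. \<Sum>i\<in>I. c i * \<phi> i x)} = range P" by (auto simp: P_def)
  have ipP: "?ip (P b) (P c) = (\<Sum>i\<in>I. r i * (l i)\<^sup>2 * (b i * c i))" for b c
    by (intro sum.cong) (simp_all add: L power2_eq_square algebra_simps)
  have pos: "r i * (l i)\<^sup>2 > 0" if "i \<in> I" for i using l[OF that] r[OF that] by simp
  show ?thesis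
    unfolding H
  proof (unfold_locales, unfold restrict_UNIV)
    show "range P \<subseteq> extensional UNIV" by simp
    have "(\<lambda>x. 0) = P (\<lambda>_. 0)" by (simp add: P_def)
    then show "(\<lambda>x. 0) \<in> range P" by simp
  next
    fix f g assume "f \<in> range P" "g \<in> range P"
    then show "(\<lambda>x. f x + g x) \<in> range P" using Padd by fastforce
  next
    fix f r assume "f \<in> range P"
    then show "(\<lambda>x. r * f x) \<in> range P" using Pscale by fastforce
  next
    fix f g
    show "?ip f g = ?ip g f" by (simp add: ac_simps)
  next
    fix f g h assume "f \<in> range P" "g \<in> range P"
    then obtain b c where fg: "f = P b" "g = P c" by blast
    show "?ip (\<lambda>x. f x + g x) h = ?ip f h + ?ip g h"
      unfolding fg Padd sum.distrib[symmetric]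
      by (intro sum.cong) (simp_all add: L algebra_simps)
  next
    fix f g t assume "f \<in> range P"
    then obtain b where f: "f = P b" by blast
    show "?ip (\<lambda>x. t * f x) g = t * ?ip f g"
      unfolding f Pscale sum_distrib_left
      by (intro sum.cong) (simp_all add: L algebra_simps)
  next
    fix f assume "f \<in> range P" and nz: "f \<noteq> (\<lambda>x. 0)"
    then obtain b where f: "f = P b" by blast
    have "\<exists>i\<in>I. b i \<noteq> 0"
      using nz unfolding f P_def by (metis (no_types, lifting) mult_zero_left sum.neutral)
    then obtain i where "i \<in> I" "b i \<noteq> 0" by blast
    then show "0 < ?ip f f"
      unfolding f ipP using pos
      by (intro sum_pos2[OF I, of i]) (auto simp flip: power2_eq_square simp: less_imp_le)
  next
    fix s :: "nat \<Rightarrow> 'v \<Rightarrow> real"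
    assume sP: "\<And>n. s n \<in> range P" and
      C: "\<forall>e>0. \<exists>N. \<forall>m\<ge>N. \<forall>n\<ge>N.
        sqrt (?ip (fun_diff UNIV (s m) (s n)) (fun_diff UNIV (s m) (s n))) < e"
    have "\<forall>n. \<exists>c. s n = P c" using sP by blast
    then obtain c where s: "\<And>n. s n = P (c n)" by metis
    have "convergent (\<lambda>n. c n i)" if i: "i \<in> I" for i
    proof (rule Cauchy_convergent, rule metric_CauchyI)
      fix e :: real assume "e > 0"
      (* A single term bounds the norm from below, so Cauchy in norm implies Cauchy in each coefficient. *)
      define q where "q = r i * (l i)\<^sup>2"
      have q: "q > 0" using pos[OF i] by (simp add: q_def)
      obtain N where N: "\<And>m n. m \<ge> N \<Longrightarrow> n \<ge> N \<Longrightarrow>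
          sqrt (?ip (fun_diff UNIV (s m) (s n)) (fun_diff UNIV (s m) (s n))) < sqrt q * e"
        using C[rule_format, of "sqrt q * e"] q \<open>e > 0\<close> by auto
      have "dist (c m i) (c n i) < e" if "m \<ge> N" "n \<ge> N" for m n
      proof -
        have "sqrt q * \<bar>c m i - c n i\<bar> = sqrt (q * (c m i - c n i)\<^sup>2)"
          by (simp add: real_sqrt_mult)
        also have "\<dots> \<le> sqrt (\<Sum>j\<in>I. r j * (l j)\<^sup>2 * ((c m j - c n j) * (c m j - c n j)))"
          unfolding q_def power2_eq_square[of "c m i - c n i"]
          using pos by (intro real_sqrt_le_mono member_le_sum[OF i _ I])
            (auto simp flip: power2_eq_square simp: less_imp_le)
        also have "\<dots> < sqrt q * e" using N[OF that] unfolding s Pdiff ipP .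
        finally show ?thesis using q by (simp add: dist_real_def)
      qed
      then show "\<exists>N. \<forall>m\<ge>N. \<forall>n\<ge>N. dist (c m i) (c n i) < e" by blast
    qed
    then have lim: "(\<lambda>n. c n i) \<longlonglongrightarrow> lim (\<lambda>n. c n i)" if "i \<in> I" for i
      using that by (simp add: convergent_LIMSEQ_iff)
    define b where "b i = lim (\<lambda>n. c n i)" for i
    have "(\<lambda>n. sqrt (\<Sum>i\<in>I. r i * (l i)\<^sup>2 * ((c n i - b i) * (c n i - b i)))) \<longlonglongrightarrow>
       sqrt (\<Sum>i\<in>I. r i * (l i)\<^sup>2 * ((b i - b i) * (b i - b i)))"
      by (intro tendsto_intros) (use lim in \<open>auto simp: b_def\<close>)
    then have "(\<lambda>n. sqrt (?ip (fun_diff UNIV (s n) (P b)) (fun_diff UNIV (s n) (P b)))) \<longlonglongrightarrow> 0"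
      unfolding s Pdiff ipP by simp
    then show "\<exists>f\<in>range P. (\<lambda>n. sqrt (?ip (fun_diff UNIV (s n) f) (fun_diff UNIV (s n) f))) \<longlonglongrightarrow> 0"
      by blast
  next
    fix x :: 'v
    have sec: "(\<lambda>y. \<Sum>i\<in>I. \<phi> i y * \<phi> i x / (r i * (l i)\<^sup>2)) = P (\<lambda>i. \<phi> i x / (r i * (l i)\<^sup>2))"
      by (simp add: P_def ac_simps)
    then show "(\<lambda>y. \<Sum>i\<in>I. \<phi> i y * \<phi> i x / (r i * (l i)\<^sup>2)) \<in> range P" by simp
    fix f assume "f \<in> range P"
    then obtain c where f: "f = P c" by blast
    show "?ip (\<lambda>y. \<Sum>i\<in>I. \<phi> i y * \<phi> i x / (r i * (l i)\<^sup>2)) f = f x"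
      unfolding sec f ipP unfolding P_def using l r by (intro sum.cong) (auto simp: less_imp_neq[THEN not_sym])
  qed
qed

text \<open>
  Gaussian elimination on the vectors \<open>(\<phi> i y)\<^sub>i\<close>, one coordinate at a time.  Points that represent
  the coordinates in \<open>I\<close> leave an error \<open>\<psi>\<close> in the new coordinate.  If this error is not always
  zero, one point \<open>z\<close> with \<open>\<psi> z \<noteq> 0\<close> added to them repairs it: the vector of \<open>z\<close> minus its old
  representation is zero in the coordinates of \<open>I\<close> and equals \<open>\<psi> z\<close> in the new one.
\<close>
lemma finite_point_evaluations_span:
  fixes \<phi> :: "'i \<Rightarrow> 'v \<Rightarrow> real"
  assumes "finite I"
  shows "\<exists>X. finite X \<and> X \<subseteq> \<Omega> \<and>
    (\<forall>y\<in>\<Omega>. \<exists>c. \<forall>i\<in>I. \<phi> i y = (\<Sum>x\<in>X. c x * \<phi> i x))"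
  using assms
proof (induction I rule: finite_induct)
  case empty
  then show ?case by (intro exI[of _ "{}"]) auto
next
  case (insert j I)
  then obtain X where X: "finite X" "X \<subseteq> \<Omega>"
    and "\<forall>y\<in>\<Omega>. \<exists>c. \<forall>i\<in>I. \<phi> i y = (\<Sum>x\<in>X. c x * \<phi> i x)" by blast
  then obtain c where c: "\<And>y i. y \<in> \<Omega> \<Longrightarrow> i \<in> I \<Longrightarrow> \<phi> i y = (\<Sum>x\<in>X. c y x * \<phi> i x)"
    by metis
  define \<psi> where "\<psi> y = \<phi> j y - (\<Sum>x\<in>X. c y x * \<phi> j x)" for y
  show ?case
  proof (cases "\<forall>y\<in>\<Omega>. \<psi> y = 0")
    case True
    then have "\<forall>y\<in>\<Omega>. \<forall>i\<in>insert j I. \<phi> i y = (\<Sum>x\<in>X. c y x * \<phi> i x)"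
      using c by (auto simp: \<psi>_def)
    then show ?thesis using X by blast
  next
    case False
    then obtain z where z: "z \<in> \<Omega>" "\<psi> z \<noteq> 0" by blast
    define X' where "X' = insert z X"
    have "\<exists>c'. \<forall>i\<in>insert j I. \<phi> i y = (\<Sum>x\<in>X'. c' x * \<phi> i x)" if y: "y \<in> \<Omega>" for y
    proof -
      define t where "t = \<psi> y / \<psi> z"
      (* z may already belong to X, so its two contributions are added rather than separated by cases. *)
      define c' where "c' x = (if x \<in> X then c y x - t * c z x else 0) + (if x = z then t else 0)" for x
      have sum: "(\<Sum>x\<in>X'. c' x * \<phi> i x)
        = (\<Sum>x\<in>X. c y x * \<phi> i x) + t * (\<phi> i z - (\<Sum>x\<in>X. c z x * \<phi> i x))" for i
      proof -
        have "(\<Sum>x\<in>X'. c' x * \<phi> i x)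
          = (\<Sum>x\<in>X'. if x \<in> X then (c y x - t * c z x) * \<phi> i x else 0)
            + (\<Sum>x\<in>X'. if x = z then t * \<phi> i x else 0)"
          unfolding sum.distrib[symmetric] by (intro sum.cong) (auto simp: c'_def algebra_simps)
        also have "(\<Sum>x\<in>X'. if x \<in> X then (c y x - t * c z x) * \<phi> i x else 0)
          = (\<Sum>x\<in>X. (c y x - t * c z x) * \<phi> i x)"
          using X by (subst sum.inter_restrict[symmetric]) (auto simp: X'_def intro!: sum.cong)
        also have "(\<Sum>x\<in>X'. if x = z then t * \<phi> i x else 0) = t * \<phi> i z"
          using X by (simp add: X'_def)
        finally show ?thesis
          by (simp add: algebra_simps sum_subtractf sum_distrib_left)
      qed
      have "\<phi> i y = (\<Sum>x\<in>X'. c' x * \<phi> i x)" if "i \<in> insert j I" for i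
      proof (cases "i \<in> I")
        case True
        then show ?thesis unfolding sum using c y z by simp
      next
        case False
        then have "i = j" using that by simp
        then show ?thesis unfolding sum using z by (simp add: t_def flip: \<psi>_def) (simp add: \<psi>_def)
      qed
      then show ?thesis by blast
    qed
    moreover have "finite X'" "X' \<subseteq> \<Omega>" using X z by (auto simp: X'_def)
    ultimately show ?thesis by blast
  qed
qed

section \<open>Multinomial expansion of the polynomial kernel\<close>

lemma power_over_fact_add:
  "((x::real) + y) ^ n / fact n = (\<Sum>k\<le>n. x ^ k / fact k * (y ^ (n - k) / fact (n - k)))"
  unfolding binomial_ring sum_divide_distrib
  by (intro sum.cong) (auto simp: binomial_fact)

lemma mi_abs_update: "\<zeta> i = 0 \<Longrightarrow> mi_abs (\<zeta>(i := m)) = m + mi_abs \<zeta>"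
  by (simp add: mi_abs_def sum.remove[of UNIV i])

lemma finite_mi_abs_eq: "finite {\<zeta>::'n::finite \<Rightarrow> nat. Q \<zeta> \<and> mi_abs \<zeta> = m}"
  by (rule finite_subset[OF _ finite_mi_abs_le[of m]]) auto

text \<open>
  With the division by \<open>fact n\<close> the binomial theorem becomes a convolution, so the induction on \<open>S\<close>
  only has to split a multi-index into its entry at the new element and the rest.  Multi-indices
  that vanish off \<open>S\<close> are used in order to stay within one type during the induction.
\<close>
lemma multinomial_on:
  fixes u :: "'n::finite \<Rightarrow> real"
  shows "(\<Sum>i\<in>S. u i) ^ n / fact n =
    (\<Sum>\<zeta> | (\<forall>i. i \<notin> S \<longrightarrow> \<zeta> i = 0) \<and> mi_abs \<zeta> = n. \<Prod>i\<in>S. u i ^ \<zeta> i / fact (\<zeta> i))"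
proof (induction S arbitrary: n rule: finite_induct[OF finite])
  case 1
  have "{\<zeta>::'n \<Rightarrow> nat. (\<forall>i. \<zeta> i = 0) \<and> mi_abs \<zeta> = n} = (if n = 0 then {\<lambda>_. 0} else {})"
    by (auto simp: mi_abs_def fun_eq_iff)
  then show ?case by (cases n) (simp_all del: Collect_empty_eq)
next
  case (2 j S)
  let ?A = "\<lambda>S n. {\<zeta>::'n \<Rightarrow> nat. (\<forall>i. i \<notin> S \<longrightarrow> \<zeta> i = 0) \<and> mi_abs \<zeta> = n}"
  let ?t = "\<lambda>S \<zeta>. \<Prod>i\<in>S. u i ^ \<zeta> i / fact (\<zeta> i)"
  have "(\<Sum>i\<in>insert j S. u i) ^ n / fact n
    = (\<Sum>k\<le>n. u j ^ k / fact k * ((\<Sum>i\<in>S. u i) ^ (n - k) / fact (n - k)))"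
    using 2 by (simp add: power_over_fact_add)
  also have "\<dots> = (\<Sum>k\<le>n. \<Sum>\<zeta>\<in>?A S (n - k). u j ^ k / fact k * ?t S \<zeta>)"
    unfolding 2 sum_distrib_left ..
  also have "\<dots> = (\<Sum>(k, \<zeta>)\<in>(SIGMA k:{..n}. ?A S (n - k)). u j ^ k / fact k * ?t S \<zeta>)"
    by (intro sum.Sigma) (auto intro: finite_mi_abs_eq)
  also have "\<dots> = (\<Sum>\<zeta>\<in>?A (insert j S) n. ?t (insert j S) \<zeta>)"
  proof (rule sum.reindex_bij_witness[of _ "\<lambda>\<zeta>. (\<zeta> j, \<zeta>(j := 0))" "\<lambda>(k, \<zeta>). \<zeta>(j := k)"], goal_cases)
    case (1 x)
    then show ?case using 2(2) by (auto simp: fun_eq_iff)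
  next
    case (2 x)
    then show ?case using \<open>j \<notin> S\<close> by (auto simp: mi_abs_update)
  next
    case (3 \<zeta>)
    then show ?case by simp
  next
    case (4 \<zeta>)
    have "mi_abs \<zeta> = \<zeta> j + mi_abs (\<zeta>(j := 0))" using mi_abs_update[of "\<zeta>(j := 0)" j "\<zeta> j"] by simp
    then show ?case using 4 by auto
  next
    case (5 x)
    have "?t S ((snd x)(j := fst x)) = ?t S (snd x)" using \<open>j \<notin> S\<close> by (intro prod.cong) auto
    then show ?case using \<open>j \<notin> S\<close> by (cases x) simp
  qed
  finally show ?case .
qed

lemma inner_power_eq:
  "((x::real ^ 'n) \<bullet> y) ^ n / fact n =
    (\<Sum>\<zeta> | mi_abs \<zeta> = n. mi_power x \<zeta> * mi_power y \<zeta> / mi_fact \<zeta>)"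
  using multinomial_on[of "\<lambda>i. x $ i * y $ i" UNIV n]
  by (simp add: inner_vec_def mi_power_def mi_fact_def power_mult_distrib prod.distrib prod_dividef)

lemma mi_fact_pos: "mi_fact \<zeta> > 0"
  by (simp add: mi_fact_def prod_pos)

lemma mi_fact_nonzero: "mi_fact \<zeta> \<noteq> 0"
  using mi_fact_pos[of \<zeta>] by simp

lemma weight_pos: "weight a p \<zeta> > 0"
  using mi_fact_pos[of \<zeta>] by (simp add: weight_def)

lemma poly_kernel_expansion:
  fixes x y :: "real ^ 'n"
  assumes "a \<ge> 0"
  shows "poly_kernel a p x y =
    (\<Sum>\<zeta>\<in>index_set a p. mi_power x \<zeta> * mi_power y \<zeta> / (1 / weight a p \<zeta> * (mi_fact \<zeta>)\<^sup>2))"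
proof (cases "a > 0")
  case True
  let ?I = "{\<zeta>::'n \<Rightarrow> nat. mi_abs \<zeta> \<le> p}"
  (* The binomial theorem sorts the terms by the degree k; the multi-indices of each degree k are
     then collected into the single sum over all degrees up to p. *)
  have "poly_kernel a p x y = fact p * ((x \<bullet> y + a) ^ p / fact p)"
    by (simp add: poly_kernel_def add.commute)
  also have "\<dots> = (\<Sum>k\<le>p. \<Sum>\<zeta> | \<zeta> \<in> ?I \<and> mi_abs \<zeta> = k.
      fact p * (a ^ (p - mi_abs \<zeta>) / fact (p - mi_abs \<zeta>)) * (mi_power x \<zeta> * mi_power y \<zeta> / mi_fact \<zeta>))"
    unfolding power_over_fact_add inner_power_eq sum_distrib_left sum_distrib_right
    by (intro sum.cong) (auto simp: mult_ac)
  also have "\<dots> = (\<Sum>\<zeta>\<in>?I.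
      fact p * (a ^ (p - mi_abs \<zeta>) / fact (p - mi_abs \<zeta>)) * (mi_power x \<zeta> * mi_power y \<zeta> / mi_fact \<zeta>))"
    by (intro sum.group finite_mi_abs_le) auto
  also have "\<dots> = (\<Sum>\<zeta>\<in>index_set a p. mi_power x \<zeta> * mi_power y \<zeta> / (1 / weight a p \<zeta> * (mi_fact \<zeta>)\<^sup>2))"
  proof (intro sum.cong)
    show "?I = index_set a p" using True by (simp add: index_set_def)
    fix \<zeta> :: "'n \<Rightarrow> nat"
    show "fact p * (a ^ (p - mi_abs \<zeta>) / fact (p - mi_abs \<zeta>)) * (mi_power x \<zeta> * mi_power y \<zeta> / mi_fact \<zeta>)
        = mi_power x \<zeta> * mi_power y \<zeta> / (1 / weight a p \<zeta> * (mi_fact \<zeta>)\<^sup>2)"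
      using True mi_fact_pos[of \<zeta>] by (simp add: weight_def power2_eq_square)
  qed
  finally show ?thesis .
next
  case False
  then have a: "a = 0" using assms by simp
  have "poly_kernel a p x y = fact p * ((x \<bullet> y) ^ p / fact p)"
    by (simp add: poly_kernel_def a)
  also have "\<dots> = (\<Sum>\<zeta>\<in>index_set a p. mi_power x \<zeta> * mi_power y \<zeta> / (1 / weight a p \<zeta> * (mi_fact \<zeta>)\<^sup>2))"
    unfolding inner_power_eq sum_distrib_left using mi_fact_nonzero
    by (intro sum.cong) (auto simp: a index_set_def weight_def power2_eq_square field_simps)
  finally show ?thesis .
qed

section \<open>Derivatives of polynomials at the origin\<close>

text \<open>
  The factor in the \<open>m\<close>-th derivative of \<open>x ^ n\<close>.  Because of truncated subtraction it is zero for
  \<open>m > n\<close>, so that \<open>falling n m * x ^ (n - m)\<close> is this derivative in all cases.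
\<close>
definition falling :: "nat \<Rightarrow> nat \<Rightarrow> real" where
  "falling n m = (\<Prod>j<m. real (n - j))"

lemma falling_self: "falling n n = fact n"
  by (simp add: falling_def fact_prod_rev atLeast0LessThan)

lemma falling_eq_0: "n < m \<Longrightarrow> falling n m = 0"
  by (auto simp: falling_def)

text \<open>
  The polynomial with coefficients \<open>c\<close> on \<open>S\<close>, differentiated \<open>\<mu> i\<close> times in each direction \<open>i\<close>.
\<close>
definition deriv_poly :: "('n \<Rightarrow> nat) set \<Rightarrow> (('n \<Rightarrow> nat) \<Rightarrow> real) \<Rightarrow> ('n \<Rightarrow> nat) \<Rightarrow> real ^ 'n \<Rightarrow> real" where
  "deriv_poly S c \<mu> x = (\<Sum>\<zeta>\<in>S. c \<zeta> * (\<Prod>i\<in>UNIV. falling (\<zeta> i) (\<mu> i) * (x $ i) ^ (\<zeta> i - \<mu> i)))"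

lemma partial_deriv_deriv_poly:
  "partial_deriv i (deriv_poly S c \<mu>) = deriv_poly S c (\<mu>(i := Suc (\<mu> i)))"
proof
  fix x :: "real ^ 'a"
  let ?g = "\<lambda>\<mu> \<zeta> j t. falling (\<zeta> j) (\<mu> j) * ((x + t *\<^sub>R axis i 1) $ j) ^ (\<zeta> j - \<mu> j)"
  let ?\<mu> = "\<mu>(i := Suc (\<mu> i))"
  have split: "(\<Prod>j\<in>UNIV. ?g \<mu> \<zeta> j t) = (falling (\<zeta> i) (\<mu> i) * (x $ i + t) ^ (\<zeta> i - \<mu> i)) *
      (\<Prod>j\<in>UNIV - {i}. falling (\<zeta> j) (\<mu> j) * (x $ j) ^ (\<zeta> j - \<mu> j))" for \<zeta> t
    by (subst prod.remove[of UNIV i]) (auto simp: axis_def intro!: prod.cong)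
  have split': "(\<Prod>j\<in>UNIV. falling (\<zeta> j) (?\<mu> j) * (x $ j) ^ (\<zeta> j - ?\<mu> j)) =
      (falling (\<zeta> i) (Suc (\<mu> i)) * (x $ i) ^ (\<zeta> i - Suc (\<mu> i))) *
      (\<Prod>j\<in>UNIV - {i}. falling (\<zeta> j) (\<mu> j) * (x $ j) ^ (\<zeta> j - \<mu> j))" for \<zeta>
    by (subst prod.remove[of UNIV i]) (auto intro!: prod.cong)
  have "((\<lambda>t. \<Prod>j\<in>UNIV. ?g \<mu> \<zeta> j t) has_field_derivative
      (\<Prod>j\<in>UNIV. falling (\<zeta> j) (?\<mu> j) * (x $ j) ^ (\<zeta> j - ?\<mu> j))) (at 0)" for \<zeta>
    unfolding split split' by (rule derivative_eq_intros refl)+ (simp add: falling_def)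
  then have "((\<lambda>t. deriv_poly S c \<mu> (x + t *\<^sub>R axis i 1)) has_field_derivative deriv_poly S c ?\<mu> x) (at 0)"
    unfolding deriv_poly_def by (intro DERIV_sum DERIV_cmult)
  then show "partial_deriv i (deriv_poly S c \<mu>) x = deriv_poly S c ?\<mu> x"
    unfolding partial_deriv_def by (rule DERIV_imp_deriv)
qed

text \<open>
  Only the number of occurrences of each direction enters, which settles the arbitrary order of
  differentiation in the definition of \<open>mi_deriv\<close>.
\<close>
lemma foldr_partial_deriv:
  "foldr partial_deriv is (deriv_poly S c (\<lambda>_. 0)) = deriv_poly S c (count_list is)"
proof (induction "is")
  case (Cons i "is")
  have "count_list (i # is) = (count_list is)(i := Suc (count_list is i))" by auto
  then show ?case using Cons by (simp only: foldr_Cons o_apply partial_deriv_deriv_poly)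
qed simp

lemma ex_count_list: "\<exists>is. \<forall>i::'n::finite. count_list is i = \<gamma> i"
proof -
  obtain "is" where "mset is = Abs_multiset \<gamma>" using ex_mset by blast
  then have "count (mset is) i = \<gamma> i" for i by (simp add: count_Abs_multiset)
  then show ?thesis by (auto simp: count_list_eq_length_filter count_mset)
qed

text \<open>
  At the origin a monomial differentiated \<open>\<gamma>\<close> times survives only if its exponent is exactly \<open>\<gamma>\<close>:
  a larger entry leaves a power of \<open>0\<close>, a smaller one makes the falling factorial vanish.
\<close>
lemma mi_deriv_at_0:
  fixes c :: "('n::finite \<Rightarrow> nat) \<Rightarrow> real"
  assumes "finite S" "\<gamma> \<in> S"
  shows "mi_deriv \<gamma> (\<lambda>x. \<Sum>\<zeta>\<in>S. c \<zeta> * mi_power x \<zeta>) 0 = mi_fact \<gamma> * c \<gamma>"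
proof -
  define "is" where "is = (SOME is. \<forall>i. count_list is i = \<gamma> i)"
  have "\<forall>i. count_list is i = \<gamma> i" unfolding is_def by (rule someI_ex[OF ex_count_list])
  then have count: "count_list is = \<gamma>" by auto
  have "(\<lambda>x. \<Sum>\<zeta>\<in>S. c \<zeta> * mi_power x \<zeta>) = deriv_poly S c (\<lambda>_. 0)"
    by (simp add: deriv_poly_def falling_def mi_power_def fun_eq_iff)
  then have "mi_deriv \<gamma> (\<lambda>x. \<Sum>\<zeta>\<in>S. c \<zeta> * mi_power x \<zeta>) 0 = deriv_poly S c \<gamma> 0"
    unfolding mi_deriv_def is_def[symmetric] by (simp add: foldr_partial_deriv count)
  also have "\<dots> = (\<Sum>\<zeta>\<in>S. if \<zeta> = \<gamma> then mi_fact \<gamma> * c \<gamma> else 0)"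
    unfolding deriv_poly_def
  proof (intro sum.cong refl)
    fix \<zeta>
    have "(\<Prod>i\<in>UNIV. falling (\<zeta> i) (\<gamma> i) * ((0::real ^ 'n) $ i) ^ (\<zeta> i - \<gamma> i)) = 0" if ne: "\<zeta> \<noteq> \<gamma>"
    proof -
      obtain i where "\<zeta> i \<noteq> \<gamma> i" using ne by (auto simp: fun_eq_iff)
      then have "falling (\<zeta> i) (\<gamma> i) * ((0::real ^ 'n) $ i) ^ (\<zeta> i - \<gamma> i) = 0"
        by (cases "\<zeta> i < \<gamma> i") (auto simp: falling_eq_0 power_0_left)
      then show ?thesis by (intro prod_zero) auto
    qed
    then show "c \<zeta> * (\<Prod>i\<in>UNIV. falling (\<zeta> i) (\<gamma> i) * ((0::real ^ 'n) $ i) ^ (\<zeta> i - \<gamma> i))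
        = (if \<zeta> = \<gamma> then mi_fact \<gamma> * c \<gamma> else 0)"
      by (auto simp: falling_self mi_fact_def)
  qed
  also have "\<dots> = mi_fact \<gamma> * c \<gamma>" using assms by simp
  finally show ?thesis .
qed

section \<open>The native space of the polynomial kernel\<close>

lemma poly_space_eq:
  "(poly_space a p :: (real ^ 'n \<Rightarrow> real) set)
    = {F. \<exists>c. F = (\<lambda>x. \<Sum>\<zeta>\<in>index_set a p. c \<zeta> * mi_power x \<zeta>)}"
  by (simp add: poly_space_def polys_def hom_polys_def index_set_def)

lemma native_space_poly_UNIV:
  assumes "a \<ge> 0"
  shows "native_space UNIV (poly_kernel a p :: real ^ 'n \<Rightarrow> _) (poly_space a p) (poly_ip a p)"
proof -
  have "native_space UNIV
      (\<lambda>y x::real ^ 'n. \<Sum>\<zeta>\<in>index_set a p. mi_power y \<zeta> * mi_power x \<zeta> / (1 / weight a p \<zeta> * (mi_fact \<zeta>)\<^sup>2))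
      {F. \<exists>c. F = (\<lambda>x. \<Sum>\<zeta>\<in>index_set a p. c \<zeta> * mi_power x \<zeta>)}
      (\<lambda>F G. \<Sum>\<gamma>\<in>index_set a p. 1 / weight a p \<gamma> * mi_deriv \<gamma> F 0 * mi_deriv \<gamma> G 0)"
    by (intro finite_feature_native_space mi_deriv_at_0 finite_index_set)
      (simp_all add: weight_pos mi_fact_nonzero)
  moreover have "(poly_kernel a p :: real ^ 'n \<Rightarrow> _) = (\<lambda>y x. \<Sum>\<zeta>\<in>index_set a p.
      mi_power y \<zeta> * mi_power x \<zeta> / (1 / weight a p \<zeta> * (mi_fact \<zeta>)\<^sup>2))"
    by (intro ext poly_kernel_expansion assms)
  moreover have "poly_ip a p = (\<lambda>F G::real ^ 'n \<Rightarrow> real.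
      \<Sum>\<gamma>\<in>index_set a p. 1 / weight a p \<gamma> * mi_deriv \<gamma> F 0 * mi_deriv \<gamma> G 0)"
    by (intro ext) (rule poly_ip_def)
  ultimately show ?thesis by (simp only: poly_space_eq)
qed

text \<open>
  The section at \<open>y\<close> depends linearly on the values of the finitely many monomials at \<open>y\<close>, so a
  representation of these values by those at finitely many nodes carries over to the sections.
\<close>
lemma poly_kernel_spanning_nodes:
  fixes \<Omega> :: "(real ^ 'n) set"
  assumes "a \<ge> 0"
  shows "\<exists>X. spanning_nodes UNIV \<Omega> (poly_kernel a p) X"
proof -
  let ?I = "index_set a p :: ('n \<Rightarrow> nat) set"
  have "\<exists>X. finite X \<and> X \<subseteq> \<Omega> \<and>
      (\<forall>y\<in>\<Omega>. \<exists>c. \<forall>\<zeta>\<in>?I. mi_power y \<zeta> = (\<Sum>x\<in>X. c x * mi_power x \<zeta>))"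
    by (rule finite_point_evaluations_span[OF finite_index_set])
  then obtain X where X: "finite X" "X \<subseteq> \<Omega>"
    and c: "\<forall>y\<in>\<Omega>. \<exists>c. \<forall>\<zeta>\<in>?I. mi_power y \<zeta> = (\<Sum>x\<in>X. c x * mi_power x \<zeta>)"
    by (elim exE conjE)
  have "\<exists>c. (\<lambda>z\<in>UNIV. poly_kernel a p z y) = kernel_comb UNIV (poly_kernel a p) X c" if y: "y \<in> \<Omega>" for y
  proof -
    obtain c where c: "\<And>\<zeta>. \<zeta> \<in> ?I \<Longrightarrow> mi_power y \<zeta> = (\<Sum>x\<in>X. c x * mi_power x \<zeta>)" using c y by blast
    have "poly_kernel a p z y = (\<Sum>x\<in>X. c x * poly_kernel a p z x)" for z
    proof -
      let ?w = "\<lambda>\<zeta>. 1 / weight a p \<zeta> * (mi_fact \<zeta>)\<^sup>2"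
      have "poly_kernel a p z y = (\<Sum>\<zeta>\<in>?I. \<Sum>x\<in>X. c x * (mi_power z \<zeta> * mi_power x \<zeta> / ?w \<zeta>))"
        unfolding poly_kernel_expansion[OF assms]
        by (intro sum.cong) (simp_all add: c sum_distrib_left sum_divide_distrib mult_ac)
      also have "\<dots> = (\<Sum>x\<in>X. c x * poly_kernel a p z x)"
        unfolding poly_kernel_expansion[OF assms] sum_distrib_left by (rule sum.swap)
      finally show ?thesis .
    qed
    then show ?thesis by (auto simp: kernel_comb_def)
  qed
  then show ?thesis using X by (auto simp: spanning_nodes_def)
qed

lemma spanning_nodes_subset:
  assumes "spanning_nodes \<Omega> \<Theta> k X" "\<Theta> \<subseteq> \<Omega>"
  shows "spanning_nodes \<Theta> \<Theta> k X"
  unfolding spanning_nodes_def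
proof (intro conjI ballI)
  fix y assume "y \<in> \<Theta>"
  then obtain c where c: "(\<lambda>z\<in>\<Omega>. k z y) = kernel_comb \<Omega> k X c"
    using assms by (auto simp: spanning_nodes_def)
  have "k z y = (\<Sum>x\<in>X. c x * k z x)" if "z \<in> \<Omega>" for z
    using fun_cong[OF c, of z] that by (simp add: kernel_comb_def)
  then have "(\<lambda>z\<in>\<Theta>. k z y) = kernel_comb \<Theta> k X c"
    using assms(2) by (auto simp: kernel_comb_def intro!: restrict_ext)
  then show "\<exists>c. (\<lambda>z\<in>\<Theta>. k z y) = kernel_comb \<Theta> k X c" by blast
qed (use assms in \<open>auto simp: spanning_nodes_def\<close>)

lemma poly_rep_eq: "poly_rep a p \<Omega> = min_norm_extension (poly_space a p) (poly_ip a p) \<Omega>"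
  by (simp add: fun_eq_iff poly_rep_def min_norm_extension_def)

theorem theorem11:
  fixes a :: real and p :: nat and \<Omega> :: "(real ^ 'n) set"
    and H :: "(real ^ 'n \<Rightarrow> real) set"
    and ip :: "(real ^ 'n \<Rightarrow> real) \<Rightarrow> (real ^ 'n \<Rightarrow> real) \<Rightarrow> real"
  assumes "a \<ge> 0"
  shows "(native_space \<Omega> (poly_kernel a p) H ip \<longleftrightarrow>
            H = poly_space_on a p \<Omega> \<and>
            (\<forall>f\<in>H. \<forall>g\<in>H. ip f g =
               (\<Sum>\<gamma>\<in>index_set a p. 1 / weight a p \<gamma> *
                  mi_deriv \<gamma> (poly_rep a p \<Omega> f) 0 * mi_deriv \<gamma> (poly_rep a p \<Omega> g) 0))) \<and>
         (inj_on (\<lambda>F. restrict F \<Omega>) (poly_space a p) \<longrightarrow>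
           (native_space \<Omega> (poly_kernel a p) H ip \<longleftrightarrow>
              H = poly_space_on a p \<Omega> \<and>
              (\<forall>F\<in>poly_space a p. \<forall>G\<in>poly_space a p. ip (restrict F \<Omega>) (restrict G \<Omega>) =
                 (\<Sum>\<gamma>\<in>index_set a p. 1 / weight a p \<gamma> *
                    mi_deriv \<gamma> F 0 * mi_deriv \<gamma> G 0))))"
proof -
  let ?k = "poly_kernel a p :: real ^ 'n \<Rightarrow> real ^ 'n \<Rightarrow> real"
  let ?rep = "poly_rep a p \<Omega>"
  obtain X where X: "spanning_nodes UNIV \<Omega> ?k X" using poly_kernel_spanning_nodes[OF assms] by blast
  have nodes: "spanning_nodes \<Omega> \<Omega> ?k X" by (rule spanning_nodes_subset[OF X]) simp
  have P: "native_space \<Omega> ?k (poly_space_on a p \<Omega>) (\<lambda>f g. poly_ip a p (?rep f) (?rep g))"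
    unfolding poly_space_on_def poly_rep_eq
    by (rule native_space_restrict[OF native_space_poly_UNIV[OF assms] subset_UNIV X])
  have iff: "native_space \<Omega> ?k H ip \<longleftrightarrow>
      H = poly_space_on a p \<Omega> \<and> (\<forall>f\<in>H. \<forall>g\<in>H. ip f g = poly_ip a p (?rep f) (?rep g))"
    using native_space_unique[OF _ P nodes, of H ip] native_space_cong[OF P, of ip] by blast
  have "(\<forall>f\<in>H. \<forall>g\<in>H. ip f g = poly_ip a p (?rep f) (?rep g)) \<longleftrightarrow>
      (\<forall>F\<in>poly_space a p. \<forall>G\<in>poly_space a p. ip (restrict F \<Omega>) (restrict G \<Omega>) = poly_ip a p F G)"
    if inj: "inj_on (\<lambda>F. restrict F \<Omega>) (poly_space a p)" and H: "H = poly_space_on a p \<Omega>"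
    unfolding H poly_space_on_def by (simp add: poly_rep_restrict[OF inj])
  with iff show ?thesis unfolding poly_ip_def by blast
qed

end
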